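(* A measure $\rho$ on $\mathbb{R}^d$ is log-concave if and only if it satisfies the Prékopa-Leindler property.
   Context: Measure on $\mathbb{R}^d$ means positive Radon (locally finite Borel) measure; $\rho(f)=\int f\,d\rho$; "positive" function means nonnegative. A function $\theta:\mathbb{R}^d\to[0,\infty)$ is log-concave if $\theta(sx+ty)\ge\theta(x)^s\theta(y)^t$ for all $x,y$ and $s,t\ge 0$, $s+t=1$ (convention $0^0=1$; zero values are allowed, so log-concave functions may have compact support). Log-concave measure: $\rho$ on $\mathbb{R}^d$ is called log-concave if every convolution $\theta\star\rho$, $(\theta\star\rho)(x)=\int\theta(x-y)\,\rho(dy)$, of $\rho$ with a log-concave continuous function $\theta$ of compact support has a log-concave density with respect to Lebesgue measure. Prékopa-Leindler property: $\rho$ satisfies it if for all $s,t\ge 0$ with $s+t=1$ and all positive continuous functions of compact support $a,b,c$ on $\mathbb{R}^d$ such that $a(sx+ty)\ge b(x)^s c(y)^t$ for all $x,y\in\mathbb{R}^d$, one has $\rho(a)\ge\rho(b)^s\rho(c)^t$. *)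

theory Defs
  imports "HOL-Analysis.Analysis"
begin

definition radon_measure :: "'a::euclidean_space measure \<Rightarrow> bool" where
  "radon_measure \<rho> \<longleftrightarrow>
     sets \<rho> = sets borel \<and>
     (\<forall>x. \<exists>U. open U \<and> x \<in> U \<and> emeasure \<rho> U < \<infinity>)"

text \<open>Real powers of nonnegative bases with the convention that zero to the power zero
  equals one; the library has \<open>0 powr 0 = 0\<close>.\<close>

definition rpow :: "real \<Rightarrow> real \<Rightarrow> real" (infixr \<open>rpow\<close> 80) where
  "x rpow s = (if s = 0 then 1 else x powr s)"

definition log_concave_fun :: "('a::euclidean_space \<Rightarrow> real) \<Rightarrow> bool" where
  "log_concave_fun \<theta> \<longleftrightarrow>
     (\<forall>x. 0 \<le> \<theta> x) \<and>
     (\<forall>x y s t. 0 \<le> s \<longrightarrow> 0 \<le> t \<longrightarrow> s + t = 1 \<longrightarrow>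
        \<theta> (s *\<^sub>R x + t *\<^sub>R y) \<ge> \<theta> x rpow s * \<theta> y rpow t)"

definition compact_support :: "('a::euclidean_space \<Rightarrow> real) \<Rightarrow> bool" where
  "compact_support f \<longleftrightarrow> compact (closure {x. f x \<noteq> 0})"

definition convol :: "('a::euclidean_space \<Rightarrow> real) \<Rightarrow> 'a measure \<Rightarrow> 'a \<Rightarrow> real" where
  "convol \<theta> \<rho> x = (LINT y|\<rho>. \<theta> (x - y))"

definition has_log_concave_density :: "'a::euclidean_space measure \<Rightarrow> bool" where
  "has_log_concave_density \<mu> \<longleftrightarrow>
     (\<exists>g. g \<in> borel_measurable borel \<and> log_concave_fun g \<and>
          \<mu> = density lborel (\<lambda>x. ennreal (g x)))"

text \<open>The convolution of a function with \<open>\<rho>\<close> is a function, identified here with the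
  measure having it as Lebesgue density. A log-concave density is thus a log-concave
  version of the convolution, which may differ from it on a Lebesgue null set.\<close>

definition log_concave_measure :: "'a::euclidean_space measure \<Rightarrow> bool" where
  "log_concave_measure \<rho> \<longleftrightarrow>
     (\<forall>\<theta>. log_concave_fun \<theta> \<longrightarrow> continuous_on UNIV \<theta> \<longrightarrow> compact_support \<theta> \<longrightarrow>
        has_log_concave_density (density lborel (\<lambda>x. ennreal (convol \<theta> \<rho> x))))"

definition positive_cc :: "('a::euclidean_space \<Rightarrow> real) \<Rightarrow> bool" where
  "positive_cc f \<longleftrightarrow> (\<forall>x. 0 \<le> f x) \<and> continuous_on UNIV f \<and> compact_support f"

definition prekopa_leindler :: "'a::euclidean_space measure \<Rightarrow> bool" where
  "prekopa_leindler \<rho> \<longleftrightarrow>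
     (\<forall>s t a b c. 0 \<le> s \<longrightarrow> 0 \<le> t \<longrightarrow> s + t = 1 \<longrightarrow>
        positive_cc a \<longrightarrow> positive_cc b \<longrightarrow> positive_cc c \<longrightarrow>
        (\<forall>x y. a (s *\<^sub>R x + t *\<^sub>R y) \<ge> b x rpow s * c y rpow t) \<longrightarrow>
        (LINT x|\<rho>. a x) \<ge> (LINT x|\<rho>. b x) rpow s * (LINT x|\<rho>. c x) rpow t)"

end

theory Submission
  imports Defs
begin

text \<open>
  Log-concavity of a Radon measure \<open>\<rho>\<close> and the Prekopa-Leindler property are linked by the classical
  Prekopa-Leindler inequality for Lebesgue measure.

  That the property implies log-concavity is direct. For log-concave \<open>\<theta>\<close>, the functions
  \<open>\<theta> (x - _)\<close>, \<open>\<theta> (y - _)\<close> and \<open>\<theta> (s *\<^sub>R x + t *\<^sub>R y - _)\<close> satisfy the hypothesis of the property, and its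
  conclusion says that \<open>convol \<theta> \<rho>\<close> is log-concave at \<open>x\<close> and \<open>y\<close>
  (\<open>prekopa_leindler_imp_log_concave_measure\<close>).

  Conversely, let \<open>\<rho>\<close> be log-concave and let \<open>\<theta>\<close> be a log-concave bump with small support. The
  convolution has a log-concave density \<open>g\<close>. If \<open>a\<close>, \<open>b\<close>, \<open>c\<close> satisfy the hypothesis of the property, so do
  \<open>a * g\<close>, \<open>b * g\<close>, \<open>c * g\<close>, and the inequality for Lebesgue measure
  (\<open>prekopa_leindler_lborel\<close>) yields the property for the smoothed measure. Normalised smoothings converge to
  \<open>\<rho>\<close> when tested against continuous functions of compact support (\<open>tent_average_tendsto\<close>), and the
  inequality survives the limit (\<open>log_concave_measure_imp_prekopa_leindler\<close>).

  The inequality for Lebesgue measure is proved on the line by comparing superlevel sets with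
  the one-dimensional Brunn-Minkowski inequality (\<open>brunn_minkowski_real\<close>), and in higher dimension by
  integrating out one coordinate at a time (\<open>prekopa_leindler_PiM\<close>).
\<close>

section \<open>The Brunn-Minkowski inequality on the line\<close>

text \<open>
  Cuts at points of \<open>B\<close> itself are what the Brunn-Minkowski argument can translate into the sum
  set. They exhaust \<open>B\<close> up to at most one point, its largest element, which is a null set.
\<close>

lemma emeasure_eq_SUP_initial_segments:
  fixes B :: "real set"
  assumes [measurable]: "B \<in> sets borel" and "B \<noteq> {}"
  shows "emeasure lborel B = (SUP x\<in>B. emeasure lborel (B \<inter> {..<x}))" (is "_ = ?k")
proof (rule antisym)
  show "?k \<le> emeasure lborel B"
    by (intro SUP_least emeasure_mono) auto
  have below: "emeasure lborel (B \<inter> {..m}) \<le> ?k" if "x \<in> B" "m < x" for m x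
    by (rule order_trans[OF emeasure_mono SUP_upper[OF that(1)]]) (use that in auto)
  \<comment> \<open>If \<open>B\<close> is bounded above, \<open>\<alpha>\<close> is its supremum, which may be attained; otherwise \<open>u\<close> exceeds every point and any \<open>\<alpha>\<close> will do.\<close>
  obtain u \<alpha> where u: "incseq u" "\<And>n. \<exists>x\<in>B. u n < x"
      and cover: "\<And>x. x \<in> B \<Longrightarrow> x \<noteq> \<alpha> \<Longrightarrow> \<exists>n. x \<le> u n"
  proof (cases "bdd_above B")
    case True
    define u where "u n = Sup B - 1 / real (Suc n)" for n
    show ?thesis
    proof
      show "incseq u"
        by (auto simp: u_def incseq_def field_simps)
      show "\<exists>x\<in>B. u n < x" for n
        using less_cSupD[OF \<open>B \<noteq> {}\<close>, of "u n"] by (auto simp: u_def)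
      show "\<exists>n. x \<le> u n" if "x \<in> B" "x \<noteq> Sup B" for x
      proof -
        have "x < Sup B" using that cSup_upper[OF _ True, of x] by auto
        then obtain n where "1 / real (Suc n) < Sup B - x"
          by (metis diff_gt_0_iff_gt nat_approx_posE)
        then show ?thesis by (auto simp: u_def intro!: exI[of _ n])
      qed
    qed
  next
    case False
    show ?thesis
    proof
      show "incseq real" by (auto simp: incseq_def)
      show "\<exists>x\<in>B. real n < x" for n
        using False by (meson bdd_above.I not_le)
      show "\<exists>n. x \<le> real n" for x by (rule real_arch_simple)
    qed
  qed
  have "emeasure lborel B \<le> emeasure lborel ((\<Union>n. B \<inter> {..u n}) \<union> {\<alpha>})"
    using cover by (intro emeasure_mono) auto
  also have "\<dots> \<le> emeasure lborel (\<Union>n. B \<inter> {..u n}) + emeasure lborel {\<alpha>}"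
    by (intro emeasure_subadditive) auto
  also have "\<dots> = (SUP n. emeasure lborel (B \<inter> {..u n}))"
    using u(1) by (subst SUP_emeasure_incseq) (auto simp: incseq_def intro: order_trans)
  also have "\<dots> \<le> ?k"
    using u(2) below by (intro SUP_least) blast
  finally show "emeasure lborel B \<le> ?k" .
qed

lemma emeasure_eq_SUP_final_segments:
  fixes C :: "real set"
  assumes [measurable]: "C \<in> sets borel" and "C \<noteq> {}"
  shows "emeasure lborel C = (SUP y\<in>C. emeasure lborel (C \<inter> {y<..}))"
proof -
  have reflect: "emeasure lborel (uminus ` S) = emeasure lborel S" if "S \<in> sets borel" for S :: "real set"
  proof -
    have "emeasure lborel S = emeasure (distr lborel borel uminus) S"
      by (simp add: lborel_distr_uminus)
    also have "\<dots> = emeasure lborel (uminus -` S)"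
      using that by (subst emeasure_distr) auto
    also have "uminus -` S = uminus ` S"
      by (force simp: image_iff)
    finally show ?thesis by simp
  qed
  have m[measurable]: "uminus ` C \<in> sets borel"
  proof -
    have "uminus ` C = uminus -` C \<inter> space borel" by (force simp: image_iff)
    also have "\<dots> \<in> sets borel" by measurable
    finally show ?thesis .
  qed
  have "emeasure lborel C = (SUP x\<in>uminus ` C. emeasure lborel (uminus ` C \<inter> {..<x}))"
    using emeasure_eq_SUP_initial_segments[OF m] assms reflect[of C] by simp
  also have "\<dots> = (SUP y\<in>C. emeasure lborel (uminus ` (C \<inter> {y<..})))"
    by (simp add: image_image) (intro SUP_cong arg_cong2[where f=emeasure]; force)
  also have "\<dots> = (SUP y\<in>C. emeasure lborel (C \<inter> {y<..}))"
    by (intro SUP_cong reflect) auto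
  finally show ?thesis .
qed

text \<open>
  For \<open>x \<in> B\<close> and \<open>y \<in> C\<close>, the set \<open>A\<close> contains on the left of \<open>s * x + t * y\<close> an affine copy of
  \<open>B \<inter> {..<x}\<close>, scaled by \<open>s\<close>, and on its right an affine copy of \<open>C \<inter> {y<..}\<close>, scaled
  by \<open>t\<close>. These copies are disjoint, and they exhaust the sizes of \<open>B\<close> and \<open>C\<close> as \<open>x\<close> moves up and
  \<open>y\<close> moves down.
\<close>

lemma brunn_minkowski_real:
  fixes A B C :: "real set" and s t :: real
  assumes [measurable]: "A \<in> sets borel" "B \<in> sets borel" "C \<in> sets borel"
    and ne: "B \<noteq> {}" "C \<noteq> {}" and st: "0 < s" "0 < t"
    and sub: "\<And>x y. x \<in> B \<Longrightarrow> y \<in> C \<Longrightarrow> s * x + t * y \<in> A"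
  shows "ennreal s * emeasure lborel B + ennreal t * emeasure lborel C \<le> emeasure lborel A"
proof -
  have affine: "ennreal c * emeasure lborel T \<le> emeasure lborel S"
    if [measurable]: "S \<in> sets borel" "T \<in> sets borel" and "0 < c"
      and T: "\<And>x. x \<in> T \<Longrightarrow> d + c * x \<in> S" for c d and S T :: "real set"
  proof -
    have "ennreal c * emeasure lborel T = ennreal c * (\<integral>\<^sup>+x. indicator T x \<partial>lborel)"
      by simp
    also have "\<dots> \<le> ennreal c * (\<integral>\<^sup>+x. indicator S (d + c * x) \<partial>lborel)"
      using T by (intro mult_left_mono nn_integral_mono) (auto split: split_indicator)
    also have "\<dots> = (\<integral>\<^sup>+x. indicator S x \<partial>lborel)"
      using \<open>0 < c\<close> by (subst nn_integral_real_affine[of "indicator S" c d]) auto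
    finally show ?thesis by simp
  qed
  have "ennreal s * emeasure lborel (B \<inter> {..<x}) + ennreal t * emeasure lborel (C \<inter> {y<..})
      \<le> emeasure lborel A" if xy: "x \<in> B" "y \<in> C" for x y
  proof -
    let ?z = "s * x + t * y"
    have "ennreal s * emeasure lborel (B \<inter> {..<x}) \<le> emeasure lborel (A \<inter> {..<?z})"
      using st sub xy by (intro affine[where d="t * y"]) (auto simp: add.commute)
    moreover have "ennreal t * emeasure lborel (C \<inter> {y<..}) \<le> emeasure lborel (A \<inter> {?z<..})"
      using st sub xy by (intro affine[where d="s * x"]) auto
    ultimately have "ennreal s * emeasure lborel (B \<inter> {..<x}) + ennreal t * emeasure lborel (C \<inter> {y<..})
        \<le> emeasure lborel (A \<inter> {..<?z}) + emeasure lborel (A \<inter> {?z<..})"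
      by (rule add_mono)
    also have "\<dots> = emeasure lborel (A \<inter> {..<?z} \<union> A \<inter> {?z<..})"
      by (intro plus_emeasure) auto
    also have "\<dots> \<le> emeasure lborel A"
      by (intro emeasure_mono) auto
    finally show ?thesis .
  qed
  then have le: "(SUP x\<in>B. SUP y\<in>C. ennreal s * emeasure lborel (B \<inter> {..<x})
      + ennreal t * emeasure lborel (C \<inter> {y<..})) \<le> emeasure lborel A"
    by (intro SUP_least)
  have "ennreal s * emeasure lborel B = (SUP x\<in>B. ennreal s * emeasure lborel (B \<inter> {..<x}))"
    "ennreal t * emeasure lborel C = (SUP y\<in>C. ennreal t * emeasure lborel (C \<inter> {y<..}))"
    using ne by (simp_all add: emeasure_eq_SUP_initial_segments[of B] emeasure_eq_SUP_final_segments[of C]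
        SUP_mult_left_ennreal)
  moreover have "(SUP y\<in>C. d + f y) = d + (SUP y\<in>C. f y)" for d :: ennreal and f
    using ne by (simp add: add.commute[of d] ennreal_SUP_add_left)
  ultimately have "ennreal s * emeasure lborel B + ennreal t * emeasure lborel C
    = (SUP x\<in>B. SUP y\<in>C. ennreal s * emeasure lborel (B \<inter> {..<x}) + ennreal t * emeasure lborel (C \<inter> {y<..}))"
    using ne by (simp add: ennreal_SUP_add_left)
  with le show ?thesis by simp
qed

section \<open>The Prekopa-Leindler inequality for Lebesgue measure\<close>

text \<open>
  Tonelli's theorem applied to the region under the graph of \<open>f\<close>.
\<close>

lemma (in sigma_finite_measure) nn_integral_layer_cake:
  assumes [measurable]: "f \<in> borel_measurable M"
  shows "(\<integral>\<^sup>+x. f x \<partial>M)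
    = (\<integral>\<^sup>+r. indicator {0..} r * emeasure M {x\<in>space M. ennreal r < f x} \<partial>lborel)"
proof -
  interpret pair_sigma_finite M "lborel :: real measure" ..
  have height: "(\<integral>\<^sup>+r. indicator {0..} r * indicator {r. ennreal r < c} r \<partial>lborel) = c" for c
  proof -
    have "(\<integral>\<^sup>+r. indicator {0..} r * indicator {r. ennreal r < c} r \<partial>lborel)
        = (\<integral>\<^sup>+r. indicator ({0..} \<inter> {r. ennreal r < c}) r \<partial>lborel)"
      by (intro nn_integral_cong) (auto split: split_indicator)
    also have "\<dots> = emeasure lborel ({0..} \<inter> {r. ennreal r < c})"
      by (rule nn_integral_indicator) measurable
    also have "\<dots> = c"
    proof (cases c)
      case (real q)
      then have "{0..} \<inter> {r. ennreal r < c} = {0..<q}"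
        by (auto simp: ennreal_less_iff)
      with real show ?thesis by simp
    next
      case top
      have "ennreal (real n) \<le> emeasure lborel {0::real..}" for n
        using emeasure_mono[of "{0..real n}" "{0::real..}" lborel] by simp
      then have "emeasure lborel {0::real..} = top"
        unfolding ennreal_of_nat_eq_real_of_nat[symmetric]
        by (metis ennreal_SUP_of_nat_eq_top SUP_least top.extremum_uniqueI)
      with top show ?thesis by (simp add: Int_absorb2)
    qed
    finally show ?thesis .
  qed
  have "(\<integral>\<^sup>+x. f x \<partial>M) = (\<integral>\<^sup>+x. \<integral>\<^sup>+r. indicator {0..} r * indicator {r. ennreal r < f x} r \<partial>lborel \<partial>M)"
    by (simp add: height)
  also have "\<dots> = (\<integral>\<^sup>+r. \<integral>\<^sup>+x. indicator {0..} r * indicator {r. ennreal r < f x} r \<partial>M \<partial>lborel)"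
    by (rule Fubini'[symmetric]) measurable
  also have "\<dots> = (\<integral>\<^sup>+r. indicator {0..} r * emeasure M {x\<in>space M. ennreal r < f x} \<partial>lborel)"
  proof (intro nn_integral_cong)
    fix r :: real
    have "(\<integral>\<^sup>+x. indicator {0..} r * indicator {r. ennreal r < f x} r \<partial>M)
       = (\<integral>\<^sup>+x. indicator {0..} r * indicator {x\<in>space M. ennreal r < f x} x \<partial>M)"
      by (intro nn_integral_cong) (auto simp: indicator_def)
    also have "\<dots> = indicator {0..} r * emeasure M {x\<in>space M. ennreal r < f x}"
      by (subst nn_integral_cmult) auto
    finally show "(\<integral>\<^sup>+x. indicator {0..} r * indicator {r. ennreal r < f x} r \<partial>M)
       = indicator {0..} r * emeasure M {x\<in>space M. ennreal r < f x}" .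
  qed
  finally show ?thesis .
qed

text \<open>
  If \<open>b\<close> and \<open>c\<close> have supremum \<open>1\<close>, then for the same levels \<open>0 \<le> r < 1\<close> both superlevel sets
  are nonempty, and the weighted sum of \<open>{b > r}\<close> and \<open>{c > r}\<close> lies in \<open>{a > r}\<close>, since
  \<open>r powr s * r powr t = r\<close>. The one-dimensional Brunn-Minkowski inequality, integrated over all
  levels, then gives a bound by the arithmetic mean, which is stronger than the one by the geometric mean.
  Without the common supremum one of the superlevel sets could be empty while the other is not.
\<close>

lemma prekopa_leindler_real_sup_1:
  fixes a :: "real \<Rightarrow> ennreal" and b c :: "real \<Rightarrow> real"
  assumes [measurable]: "a \<in> borel_measurable borel" "b \<in> borel_measurable borel" "c \<in> borel_measurable borel"
    and st: "0 < s" "0 < t" "s + t = 1"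
    and b: "\<And>x. b x \<le> 1" "\<And>r. r < 1 \<Longrightarrow> \<exists>x. r < b x"
    and c: "\<And>x. c x \<le> 1" "\<And>r. r < 1 \<Longrightarrow> \<exists>x. r < c x"
    and le: "\<And>x y. ennreal (b x powr s * c y powr t) \<le> a (s * x + t * y)"
  shows "ennreal s * (\<integral>\<^sup>+x. b x \<partial>lborel) + ennreal t * (\<integral>\<^sup>+x. c x \<partial>lborel) \<le> (\<integral>\<^sup>+x. a x \<partial>lborel)"
proof -
  have level: "ennreal s * emeasure lborel {x. ennreal r < b x} + ennreal t * emeasure lborel {x. ennreal r < c x}
      \<le> emeasure lborel {x. ennreal r < a x}" if "0 \<le> r" for r
  proof (cases "r < 1")
    case True
    show ?thesis
    proof (rule brunn_minkowski_real)
      fix x y assume "x \<in> {x. ennreal r < b x}" "y \<in> {x. ennreal r < c x}"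
      then have "r powr s < b x powr s" "r powr t < c y powr t"
        using that st by (auto simp: ennreal_less_iff intro!: powr_less_mono2)
      then have "r powr s * r powr t < b x powr s * c y powr t"
        by (intro mult_strict_mono') auto
      moreover have "r powr s * r powr t = r"
        using that st by (simp add: powr_add[symmetric])
      ultimately have "ennreal r < ennreal (b x powr s * c y powr t)"
        using that by (simp add: ennreal_less_iff)
      then show "s * x + t * y \<in> {x. ennreal r < a x}"
        using le[of x y] by auto
    qed (use st True b c that in \<open>auto simp: ennreal_less_iff\<close>)
  next
    case False
    then have "\<not> r < b x" "\<not> r < c x" for x
      using b(1)[of x] c(1)[of x] by auto
    then show ?thesis using that by (simp add: ennreal_less_iff)
  qed
  have layers: "(\<integral>\<^sup>+x. f x \<partial>lborel) = (\<integral>\<^sup>+r. indicator {0..} r * emeasure lborel {x. ennreal r < f x} \<partial>lborel)"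
    if "f \<in> borel_measurable borel" for f :: "real \<Rightarrow> ennreal"
    using lborel.nn_integral_layer_cake[of f] that by simp
  note b_layers = layers[of "\<lambda>x. ennreal (b x)"] and c_layers = layers[of "\<lambda>x. ennreal (c x)"]
  have "ennreal s * (\<integral>\<^sup>+x. b x \<partial>lborel) + ennreal t * (\<integral>\<^sup>+x. c x \<partial>lborel)
      = (\<integral>\<^sup>+r. ennreal s * (indicator {0..} r * emeasure lborel {x. ennreal r < b x})
           + ennreal t * (indicator {0..} r * emeasure lborel {x. ennreal r < c x}) \<partial>lborel)"
  proof -
    have [measurable]: "(\<lambda>r. emeasure lborel {x. ennreal r < b x}) \<in> borel_measurable lborel"
      "(\<lambda>r. emeasure lborel {x. ennreal r < c x}) \<in> borel_measurable lborel"
      by measurable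
    show ?thesis
      by (subst b_layers, simp, subst c_layers, simp) (simp add: nn_integral_add nn_integral_cmult)
  qed
  also have "\<dots> \<le> (\<integral>\<^sup>+r. indicator {0..} r * emeasure lborel {x. ennreal r < a x} \<partial>lborel)"
    using level by (intro nn_integral_mono) (auto simp: indicator_def)
  also have "\<dots> = (\<integral>\<^sup>+x. a x \<partial>lborel)"
    by (rule layers[symmetric]) simp
  finally show ?thesis .
qed

text \<open>
  Both sides scale in the same way when \<open>b\<close> and \<open>c\<close> are multiplied by constants, so bounded
  functions can be normalised to supremum \<open>1\<close>; Young's inequality then passes from the arithmetic to the geometric mean.
\<close>

lemma prekopa_leindler_real_bounded:
  fixes a :: "real \<Rightarrow> ennreal" and b c :: "real \<Rightarrow> real"
  assumes a[measurable]: "a \<in> borel_measurable borel" and b: "integrable lborel b" and c: "integrable lborel c"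
    and st: "0 < s" "0 < t" "s + t = 1"
    and b0: "\<And>x. 0 \<le> b x" "bdd_above (range b)" and c0: "\<And>x. 0 \<le> c x" "bdd_above (range c)"
    and le: "\<And>x y. ennreal (b x powr s * c y powr t) \<le> a (s * x + t * y)"
  shows "ennreal ((LINT x|lborel. b x) powr s * (LINT x|lborel. c x) powr t) \<le> (\<integral>\<^sup>+x. a x \<partial>lborel)"
proof (cases "(LINT x|lborel. b x) = 0 \<or> (LINT x|lborel. c x) = 0")
  case True
  then show ?thesis by auto
next
  case False
  define M where "M = Sup (range b)"
  define N where "N = Sup (range c)"
  define K where "K = M powr s * N powr t"
  have bM: "b x \<le> M" and cN: "c x \<le> N" for x
    unfolding M_def N_def using b0(2) c0(2) by (auto intro: cSup_upper)
  have "M > 0"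
  proof (rule ccontr)
    assume "\<not> M > 0"
    then have "b = (\<lambda>x. 0)" using bM b0(1) by (intro ext) (meson order_antisym not_less order_trans)
    with False show False by simp
  qed
  have "N > 0"
  proof (rule ccontr)
    assume "\<not> N > 0"
    then have "c = (\<lambda>x. 0)" using cN c0(1) by (intro ext) (meson order_antisym not_less order_trans)
    with False show False by simp
  qed
  have "K > 0" using \<open>M > 0\<close> \<open>N > 0\<close> by (simp add: K_def)
  have pos: "(LINT x|lborel. b x) > 0" "(LINT x|lborel. c x) > 0"
    using False b0(1) c0(1) by (auto simp: less_le intro: Bochner_Integration.integral_nonneg)
  have nn: "(\<integral>\<^sup>+x. ennreal (b x / M) \<partial>lborel) = ennreal ((LINT x|lborel. b x) / M)"
      "(\<integral>\<^sup>+x. ennreal (c x / N) \<partial>lborel) = ennreal ((LINT x|lborel. c x) / N)"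
    using b c b0(1) c0(1) \<open>M > 0\<close> \<open>N > 0\<close> by (subst nn_integral_eq_integral; simp)+
  let ?B = "(LINT x|lborel. b x) / M" and ?C = "(LINT x|lborel. c x) / N"
  have "ennreal (?B powr s * ?C powr t) \<le> ennreal (s * ?B + t * ?C)"
    using st pos \<open>M > 0\<close> \<open>N > 0\<close> by (intro ennreal_leI Youngs_inequality_0) auto
  also have "\<dots> = ennreal s * (\<integral>\<^sup>+x. ennreal (b x / M) \<partial>lborel) + ennreal t * (\<integral>\<^sup>+x. ennreal (c x / N) \<partial>lborel)"
    using st pos \<open>M > 0\<close> \<open>N > 0\<close> unfolding nn by (subst (1 2) ennreal_mult'[symmetric]) auto
  also have "\<dots> \<le> (\<integral>\<^sup>+x. ennreal (1 / K) * a x \<partial>lborel)"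
  proof (rule prekopa_leindler_real_sup_1)
    show "\<exists>x. r < b x / M" if "r < 1" for r
      using less_cSupD[of "range b" "r * M"] that \<open>M > 0\<close> by (auto simp: M_def[symmetric] pos_less_divide_eq)
    show "\<exists>x. r < c x / N" if "r < 1" for r
      using less_cSupD[of "range c" "r * N"] that \<open>N > 0\<close> by (auto simp: N_def[symmetric] pos_less_divide_eq)
    show "ennreal ((b x / M) powr s * (c y / N) powr t) \<le> ennreal (1 / K) * a (s * x + t * y)" for x y
    proof -
      have "(b x / M) powr s * (c y / N) powr t = 1 / K * (b x powr s * c y powr t)"
        using b0(1) c0(1) \<open>M > 0\<close> \<open>N > 0\<close> by (simp add: K_def powr_divide)
      then have "ennreal ((b x / M) powr s * (c y / N) powr t) = ennreal (1 / K) * ennreal (b x powr s * c y powr t)"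
        using \<open>K > 0\<close> by (simp only: ennreal_mult' zero_le_divide_1_iff less_imp_le)
      also have "\<dots> \<le> ennreal (1 / K) * a (s * x + t * y)"
        by (intro mult_left_mono le) simp
      finally show ?thesis .
    qed
  qed (use bM cN b c st \<open>M > 0\<close> \<open>N > 0\<close> in auto)
  also have "\<dots> = ennreal (1 / K) * (\<integral>\<^sup>+x. a x \<partial>lborel)"
    by (simp add: nn_integral_cmult)
  finally have "ennreal K * ennreal (?B powr s * ?C powr t)
      \<le> ennreal K * (ennreal (1 / K) * (\<integral>\<^sup>+x. a x \<partial>lborel))"
    by (rule mult_left_mono) simp
  moreover have "K * (?B powr s * ?C powr t) = (LINT x|lborel. b x) powr s * (LINT x|lborel. c x) powr t"
    using pos \<open>M > 0\<close> \<open>N > 0\<close> by (simp add: K_def powr_divide)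
  moreover have "ennreal K * ennreal (1 / K) = 1"
    using \<open>K > 0\<close> by (simp add: ennreal_mult'[symmetric])
  ultimately show ?thesis
    using \<open>K > 0\<close> by (simp add: ennreal_mult'[symmetric] mult.assoc[symmetric])
qed

text \<open>
  Truncation of \<open>b\<close> and \<open>c\<close> preserves the hypothesis, so the bounded case extends to integrable
  functions by dominated convergence. The function \<open>a\<close> takes values in \<open>ennreal\<close> because a partial
  integral of \<open>a\<close> may be infinite; in this form the inequality is stable under iterated integration.
\<close>

lemma prekopa_leindler_real:
  fixes a :: "real \<Rightarrow> ennreal" and b c :: "real \<Rightarrow> real"
  assumes a[measurable]: "a \<in> borel_measurable borel" and b: "integrable lborel b" and c: "integrable lborel c"
    and st: "0 < s" "0 < t" "s + t = 1"
    and b0: "\<And>x. 0 \<le> b x" and c0: "\<And>x. 0 \<le> c x"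
    and le: "\<And>x y. ennreal (b x powr s * c y powr t) \<le> a (s * x + t * y)"
  shows "ennreal ((LINT x|lborel. b x) powr s * (LINT x|lborel. c x) powr t) \<le> (\<integral>\<^sup>+x. a x \<partial>lborel)"
proof -
  have trunc: "integrable lborel (\<lambda>x. min (f x) (real n))"
      "(\<lambda>n. LINT x|lborel. min (f x) (real n)) \<longlonglongrightarrow> (LINT x|lborel. f x)"
    if f: "integrable lborel f" and f0: "\<And>x. 0 \<le> f x" for f :: "real \<Rightarrow> real" and n
  proof -
    show "integrable lborel (\<lambda>x. min (f x) (real n))"
      by (rule Bochner_Integration.integrable_bound[OF f]) (use f f0 in auto)
    have "(\<lambda>n. min (f x) (real n)) \<longlonglongrightarrow> f x" for x
    proof (rule tendsto_eventually)
      obtain N where "f x \<le> real N" using real_arch_simple by blast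
      then show "\<forall>\<^sub>F n in sequentially. min (f x) (real n) = f x"
        by (intro eventually_sequentiallyI[of N]) auto
    qed
    then show "(\<lambda>n. LINT x|lborel. min (f x) (real n)) \<longlonglongrightarrow> (LINT x|lborel. f x)"
      by (intro integral_dominated_convergence[where w=f]) (use f f0 in auto)
  qed
  have le_n: "ennreal ((LINT x|lborel. min (b x) (real n)) powr s * (LINT x|lborel. min (c x) (real n)) powr t)
      \<le> (\<integral>\<^sup>+x. a x \<partial>lborel)" for n
  proof (rule prekopa_leindler_real_bounded[OF a trunc(1)[OF b b0] trunc(1)[OF c c0] st])
    show "bdd_above (range (\<lambda>x. min (b x) (real n)))" "bdd_above (range (\<lambda>x. min (c x) (real n)))"
      by (auto intro!: bdd_aboveI[of _ "real n"])
    fix x y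
    have "min (b x) (real n) powr s * min (c y) (real n) powr t \<le> b x powr s * c y powr t"
      using b0 c0 st by (intro mult_mono powr_mono2) auto
    then show "ennreal (min (b x) (real n) powr s * min (c y) (real n) powr t) \<le> a (s * x + t * y)"
      using le[of x y] by (meson ennreal_leI order_trans)
  qed (use b0 c0 in auto)
  have "(\<lambda>n. ennreal ((LINT x|lborel. min (b x) (real n)) powr s * (LINT x|lborel. min (c x) (real n)) powr t))
      \<longlonglongrightarrow> ennreal ((LINT x|lborel. b x) powr s * (LINT x|lborel. c x) powr t)"
    using st b0 c0 trunc(2)[OF b b0] trunc(2)[OF c c0]
    by (intro tendsto_intros tendsto_ennrealI tendsto_powr2)
       (auto intro!: always_eventually Bochner_Integration.integral_nonneg)
  then show ?thesis
    by (rule LIMSEQ_le_const2) (use le_n in blast)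
qed

text \<open>
  Induction on the number of coordinates: the one-dimensional inequality in the coordinate \<open>i\<close>
  says that the partial integrals over this coordinate satisfy the hypothesis in the other coordinates.
\<close>

lemma prekopa_leindler_PiM:
  fixes a :: "('i \<Rightarrow> real) \<Rightarrow> ennreal" and b c :: "('i \<Rightarrow> real) \<Rightarrow> real"
  assumes "finite I"
    and "a \<in> borel_measurable (\<Pi>\<^sub>M i\<in>I. lborel)"
    and "integrable (\<Pi>\<^sub>M i\<in>I. lborel) b" and "integrable (\<Pi>\<^sub>M i\<in>I. lborel) c"
    and st: "0 < s" "0 < t" "s + t = 1"
    and "\<And>x. 0 \<le> b x" and "\<And>x. 0 \<le> c x"
    and "\<And>x y. x \<in> space (\<Pi>\<^sub>M i\<in>I. lborel) \<Longrightarrow> y \<in> space (\<Pi>\<^sub>M i\<in>I. lborel) \<Longrightarrow>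
      ennreal (b x powr s * c y powr t) \<le> a (\<lambda>i\<in>I. s * x i + t * y i)"
  shows "ennreal ((LINT x|(\<Pi>\<^sub>M i\<in>I. lborel). b x) powr s * (LINT x|(\<Pi>\<^sub>M i\<in>I. lborel). c x) powr t)
    \<le> (\<integral>\<^sup>+x. a x \<partial>(\<Pi>\<^sub>M i\<in>I. lborel))"
  using assms(1-4,8-)
proof (induction I arbitrary: a b c rule: finite_induct)
  case empty
  interpret product_sigma_finite "\<lambda>_::'i. lborel :: real measure" ..
  have "(LINT x|(\<Pi>\<^sub>M i\<in>{}. lborel). f x) = f (\<lambda>_. undefined)" for f :: "('i \<Rightarrow> real) \<Rightarrow> real"
    by (simp add: PiM_empty lebesgue_integral_count_space_finite)
  moreover have "(\<integral>\<^sup>+x. a x \<partial>(\<Pi>\<^sub>M i\<in>{}. lborel)) = a (\<lambda>_. undefined)"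
    by (simp add: PiM_empty nn_integral_count_space_finite)
  ultimately show ?case
    using empty.prems(6)[of "\<lambda>_. undefined" "\<lambda>_. undefined"] by (simp add: space_PiM restrict_def)
next
  case (insert i I)
  interpret product_sigma_finite "\<lambda>_::'i. lborel :: real measure" ..
  let ?P = "\<Pi>\<^sub>M i\<in>I. (lborel :: real measure)" and ?Q = "\<Pi>\<^sub>M i\<in>insert i I. (lborel :: real measure)"
  have upd[measurable]: "(\<lambda>v. u(i := v)) \<in> borel \<rightarrow>\<^sub>M ?Q" if "u \<in> space ?P" for u
    using measurable_fun_upd[of "insert i I" I i "\<lambda>_. u" lborel "\<lambda>_. lborel" id] that
    by (simp add: id_def)
  have [measurable]: "a \<in> borel_measurable ?Q" "b \<in> borel_measurable ?Q" "c \<in> borel_measurable ?Q"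
    using insert.prems by auto
  have partial: "integrable ?P (\<lambda>u. LINT v|lborel. f (u(i := v)))"
      "(LINT u|?P. LINT v|lborel. f (u(i := v))) = (LINT x|?Q. f x)"
    if f: "integrable ?Q f" and f0: "\<And>x. 0 \<le> f x" for f :: "('i \<Rightarrow> real) \<Rightarrow> real"
  proof -
    have [measurable]: "f \<in> borel_measurable ?Q" using f by auto
    have inner_nn: "(\<lambda>u. \<integral>\<^sup>+v. f (u(i := v)) \<partial>lborel) \<in> borel_measurable ?P"
      by measurable
    have meas[measurable]: "(\<lambda>u. LINT v|lborel. f (u(i := v))) \<in> borel_measurable ?P"
      by measurable
    have total: "(\<integral>\<^sup>+x. f x \<partial>?Q) = (\<integral>\<^sup>+u. \<integral>\<^sup>+v. f (u(i := v)) \<partial>lborel \<partial>?P)"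
      using insert.hyps by (intro product_nn_integral_insert) auto
    have "(\<integral>\<^sup>+x. f x \<partial>?Q) = ennreal (LINT x|?Q. f x)"
      using f f0 by (intro nn_integral_eq_integral) auto
    then have "AE u in ?P. (\<integral>\<^sup>+v. f (u(i := v)) \<partial>lborel) \<noteq> \<infinity>"
      unfolding total by (intro nn_integral_PInf_AE inner_nn) auto
    then have "AE u in ?P. ennreal (LINT v|lborel. f (u(i := v))) = (\<integral>\<^sup>+v. f (u(i := v)) \<partial>lborel)"
    proof (rule AE_mp, intro AE_I2 impI)
      fix u assume u[measurable]: "u \<in> space ?P" and fin: "(\<integral>\<^sup>+v. f (u(i := v)) \<partial>lborel) \<noteq> \<infinity>"
      have "integrable lborel (\<lambda>v. f (u(i := v)))"
        using fin f0 by (intro integrableI_nonneg) (auto simp: less_top)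
      then show "ennreal (LINT v|lborel. f (u(i := v))) = (\<integral>\<^sup>+v. f (u(i := v)) \<partial>lborel)"
        using f0 by (intro nn_integral_eq_integral[symmetric]) auto
    qed
    then have eq: "(\<integral>\<^sup>+u. ennreal (LINT v|lborel. f (u(i := v))) \<partial>?P) = ennreal (LINT x|?Q. f x)"
      using \<open>(\<integral>\<^sup>+x. f x \<partial>?Q) = ennreal (LINT x|?Q. f x)\<close>
      unfolding total by (simp cong: nn_integral_cong_AE)
    show "integrable ?P (\<lambda>u. LINT v|lborel. f (u(i := v)))"
      using eq f0 by (intro integrableI_nonneg) (auto intro!: AE_I2 Bochner_Integration.integral_nonneg)
    show "(LINT u|?P. LINT v|lborel. f (u(i := v))) = (LINT x|?Q. f x)"
      using eq f0 by (subst integral_eq_nn_integral)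
        (auto intro!: AE_I2 Bochner_Integration.integral_nonneg)
  qed
  \<comment> \<open>A slice of \<open>b\<close> or \<open>c\<close> that is not integrable has integral \<open>0\<close> by convention, for which the hypothesis on \<open>A\<close>, \<open>B\<close>, \<open>C\<close> is trivial.\<close>
  define A where "A u = (\<integral>\<^sup>+v. a (u(i := v)) \<partial>lborel)" for u
  define B where "B u = (LINT v|lborel. b (u(i := v)))" for u
  define C where "C u = (LINT v|lborel. c (u(i := v)))" for u
  have "ennreal ((LINT u|?P. B u) powr s * (LINT u|?P. C u) powr t) \<le> (\<integral>\<^sup>+u. A u \<partial>?P)"
  proof (rule insert.IH)
    show "A \<in> borel_measurable ?P" unfolding A_def by measurable
    show "integrable ?P B" "integrable ?P C"
      unfolding B_def C_def using partial(1) insert.prems by blast+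
    show "0 \<le> B u" "0 \<le> C u" for u
      unfolding B_def C_def using insert.prems by (auto intro!: Bochner_Integration.integral_nonneg)
    fix u w assume [measurable]: "u \<in> space ?P" and [measurable]: "w \<in> space ?P"
    define z where "z = (\<lambda>j\<in>I. s * u j + t * w j)"
    have [measurable]: "z \<in> space ?P" by (simp add: z_def space_PiM)
    show "ennreal (B u powr s * C w powr t) \<le> A (\<lambda>j\<in>I. s * u j + t * w j)"
    proof (cases "integrable lborel (\<lambda>v. b (u(i := v))) \<and> integrable lborel (\<lambda>v. c (w(i := v)))")
      case True
      show ?thesis
        unfolding A_def B_def C_def z_def[symmetric]
      proof (rule prekopa_leindler_real)
        fix x y
        have "(\<lambda>j\<in>insert i I. s * (u(i := x)) j + t * (w(i := y)) j) = z(i := s * x + t * y)"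
          using insert.hyps by (auto simp: z_def fun_eq_iff restrict_def)
        moreover have "u(i := x) \<in> space ?Q" "w(i := y) \<in> space ?Q"
          using \<open>u \<in> space ?P\<close> \<open>w \<in> space ?P\<close> by (auto simp: space_PiM PiE_iff extensional_def)
        ultimately show "ennreal (b (u(i := x)) powr s * c (w(i := y)) powr t) \<le> a (z(i := s * x + t * y))"
          using insert.prems(6)[of "u(i := x)" "w(i := y)"] by presburger
      qed (use True st insert.prems in auto)
    next
      case False
      then have "B u = 0 \<or> C w = 0"
        unfolding B_def C_def using not_integrable_integral_eq by blast
      then show ?thesis by auto
    qed
  qed
  moreover have "(\<integral>\<^sup>+u. A u \<partial>?P) = (\<integral>\<^sup>+x. a x \<partial>?Q)"
    unfolding A_def using insert.hyps by (intro product_nn_integral_insert[symmetric]) auto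
  moreover have "(LINT u|?P. B u) = (LINT x|?Q. b x)" "(LINT u|?P. C u) = (LINT x|?Q. c x)"
    unfolding B_def C_def using partial(2) insert.prems by blast+
  ultimately show ?case by simp
qed

text \<open>
  The map from coordinates to vectors carries the product measure to Lebesgue measure and commutes
  with convex combinations, so the inequality carries over from the product.
\<close>

lemma prekopa_leindler_lborel:
  fixes a :: "'a::euclidean_space \<Rightarrow> ennreal" and b c :: "'a \<Rightarrow> real"
  assumes a[measurable]: "a \<in> borel_measurable borel" and b: "integrable lborel b" and c: "integrable lborel c"
    and st: "0 < s" "0 < t" "s + t = 1"
    and b0: "\<And>x. 0 \<le> b x" and c0: "\<And>x. 0 \<le> c x"
    and le: "\<And>x y. ennreal (b x powr s * c y powr t) \<le> a (s *\<^sub>R x + t *\<^sub>R y)"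
  shows "ennreal ((LINT x|lborel. b x) powr s * (LINT x|lborel. c x) powr t) \<le> (\<integral>\<^sup>+x. a x \<partial>lborel)"
proof -
  let ?P = "\<Pi>\<^sub>M b\<in>(Basis :: 'a set). (lborel :: real measure)"
  define F where "F f = (\<Sum>i\<in>Basis. f i *\<^sub>R i :: 'a)" for f
  have F[measurable]: "F \<in> ?P \<rightarrow>\<^sub>M borel" unfolding F_def by measurable
  have lb: "(lborel :: 'a measure) = distr ?P borel F"
    unfolding F_def by (rule lborel_eq)
  have [measurable]: "b \<in> borel_measurable borel" "c \<in> borel_measurable borel"
    using b c by auto
  have "ennreal ((LINT x|?P. b (F x)) powr s * (LINT x|?P. c (F x)) powr t) \<le> (\<integral>\<^sup>+x. a (F x) \<partial>?P)"
  proof (rule prekopa_leindler_PiM)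
    show "integrable ?P (\<lambda>x. b (F x))" "integrable ?P (\<lambda>x. c (F x))"
      using b c unfolding lb by (simp_all add: integrable_distr_eq)
    show "ennreal (b (F x) powr s * c (F y) powr t) \<le> a (F (\<lambda>i\<in>Basis. s * x i + t * y i))" for x y
    proof -
      have "F (\<lambda>i\<in>Basis. s * x i + t * y i) = s *\<^sub>R F x + t *\<^sub>R F y"
        by (simp add: F_def scaleR_sum_right sum.distrib scaleR_add_left)
      then show ?thesis using le by simp
    qed
  qed (use st b0 c0 in auto)
  then show ?thesis
    unfolding lb by (simp add: integral_distr nn_integral_distr)
qed

section \<open>Continuous functions of compact support and Radon measures\<close>

lemma positive_cc_iff_zero_outside_ball:
  "positive_cc f \<longleftrightarrow> (\<forall>x. 0 \<le> f x) \<and> continuous_on UNIV f \<and> (\<exists>R. \<forall>x. f x \<noteq> 0 \<longrightarrow> norm x \<le> R)"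
proof -
  have "compact_support f \<longleftrightarrow> bounded {x. f x \<noteq> 0}"
    unfolding compact_support_def
    using bounded_closure[of "{x. f x \<noteq> 0}"] bounded_subset[OF _ closure_subset[of "{x. f x \<noteq> 0}"]]
    by (auto simp: compact_eq_bounded_closed)
  then show ?thesis by (auto simp: positive_cc_def bounded_iff)
qed

lemma positive_cc_bounded:
  assumes "positive_cc f"
  obtains K where "\<And>x. f x \<le> K"
proof -
  obtain R where R: "\<And>x. f x \<noteq> 0 \<Longrightarrow> norm x \<le> R"
    using assms by (auto simp: positive_cc_iff_zero_outside_ball)
  have "bounded (f ` cball 0 R)"
    using assms
    by (intro compact_imp_bounded compact_continuous_image)
       (auto simp: positive_cc_def intro: continuous_on_subset)
  then obtain K where "\<forall>x\<in>cball 0 R. \<bar>f x\<bar> \<le> K"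
    by (auto simp: bounded_iff)
  then have K: "\<bar>f x\<bar> \<le> K" if "norm x \<le> R" for x
    using that by simp
  show ?thesis
  proof
    show "f x \<le> max K 0" for x
      using K[of x] R[of x] by (cases "f x = 0") auto
  qed
qed

lemma positive_cc_measurable: "positive_cc f \<Longrightarrow> f \<in> borel_measurable borel"
  by (auto simp: positive_cc_def intro: borel_measurable_continuous_onI)

lemma positive_cc_mult_shift:
  assumes "positive_cc f" "positive_cc g"
  shows "positive_cc (\<lambda>z. f (y + z) * g z)"
proof -
  obtain R where R: "\<And>x. g x \<noteq> 0 \<Longrightarrow> norm x \<le> R"
    using assms(2) by (auto simp: positive_cc_iff_zero_outside_ball)
  have "continuous_on UNIV (\<lambda>z. f (y + z) * g z)"
    using assms unfolding positive_cc_def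
    by (intro continuous_on_mult continuous_on_compose2[of UNIV f "UNIV" "(+) y"]) (auto intro!: continuous_intros)
  moreover have "norm z \<le> R" if "f (y + z) * g z \<noteq> 0" for z
    using that by (intro R) auto
  moreover have "0 \<le> f (y + z) * g z" for z
    using assms by (simp add: positive_cc_def)
  ultimately show ?thesis
    unfolding positive_cc_iff_zero_outside_ball by blast
qed

lemma positive_cc_reflect:
  assumes "positive_cc f"
  shows "positive_cc (\<lambda>z. f (x - z))"
proof -
  obtain R where R: "\<And>x. f x \<noteq> 0 \<Longrightarrow> norm x \<le> R"
    using assms by (auto simp: positive_cc_iff_zero_outside_ball)
  have "norm z \<le> norm x + R" if "f (x - z) \<noteq> 0" for z
    using R[OF that] norm_triangle_ineq4[of x "x - z"] by simp
  moreover have "continuous_on UNIV (\<lambda>z. f (x - z))"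
    using assms unfolding positive_cc_def
    by (intro continuous_on_compose2[of UNIV f UNIV "(-) x"]) (auto intro!: continuous_intros)
  ultimately show ?thesis
    using assms by (auto simp: positive_cc_iff_zero_outside_ball)
qed

lemma radon_measure_compact_finite:
  assumes "radon_measure \<rho>" and "compact K"
  shows "emeasure \<rho> K < \<infinity>"
proof -
  have [measurable_cong]: "sets \<rho> = sets borel"
    using assms(1) by (simp add: radon_measure_def)
  let ?\<U> = "{U. open U \<and> emeasure \<rho> U < \<infinity>}"
  have "K \<subseteq> \<Union>?\<U>"
    using assms(1) by (auto simp: radon_measure_def)
  then obtain \<F> where \<F>: "\<F> \<subseteq> ?\<U>" "finite \<F>" "K \<subseteq> \<Union>\<F>"
    using compactE[OF assms(2), of ?\<U>] by (metis (no_types, lifting) mem_Collect_eq)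
  have "\<Union>\<F> \<in> fmeasurable \<rho>"
    using \<F> by (intro fmeasurable.finite_Union) (auto simp: fmeasurable_def)
  then have "emeasure \<rho> (\<Union>\<F>) < \<infinity>" by (simp add: fmeasurable_def)
  then show ?thesis
    using emeasure_mono[OF \<F>(3), of \<rho>] \<F> by (force simp: open_Union)
qed

lemma radon_measure_sigma_finite:
  assumes "radon_measure \<rho>"
  shows "sigma_finite_measure \<rho>"
proof
  have sets: "sets \<rho> = sets borel" using assms by (simp add: radon_measure_def)
  show "\<exists>A. countable A \<and> A \<subseteq> sets \<rho> \<and> \<Union>A = space \<rho> \<and> (\<forall>a\<in>A. emeasure \<rho> a \<noteq> \<infinity>)"
  proof (intro exI[of _ "range (\<lambda>n. cball 0 (real n))"] conjI)
    show "\<Union>(range (\<lambda>n. cball 0 (real n))) = space \<rho>"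
      using sets_eq_imp_space_eq[OF sets] real_arch_simple by auto
  qed (use sets radon_measure_compact_finite[OF assms] in \<open>auto simp: less_top\<close>)
qed

lemma radon_measure_lborel: "radon_measure lborel"
  unfolding radon_measure_def
proof (intro conjI allI)
  show "\<exists>U. open U \<and> x \<in> U \<and> emeasure lborel U < \<infinity>" for x :: 'a
    by (intro exI[of _ "ball x 1"]) (use emeasure_lborel_ball_finite[of x 1] in simp)
qed simp

text \<open>
  The product of two Radon measures is used so that integrability of a continuous function of two
  variables with compact support, as needed for Fubini's theorem, is a case of integrability against a Radon measure.
\<close>

lemma radon_measure_pair:
  assumes "radon_measure \<mu>" "radon_measure \<rho>"
  shows "radon_measure (\<mu> \<Otimes>\<^sub>M \<rho>)"
  unfolding radon_measure_def
proof (intro conjI allI)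
  interpret \<rho>: sigma_finite_measure \<rho> using assms by (rule_tac radon_measure_sigma_finite)
  have sets: "sets \<mu> = sets borel" "sets \<rho> = sets borel"
    using assms by (auto simp: radon_measure_def)
  show "sets (\<mu> \<Otimes>\<^sub>M \<rho>) = sets borel"
    using sets_pair_measure_cong[OF sets] unfolding borel_prod .
  fix p
  obtain U V where "open U" "fst p \<in> U" "emeasure \<mu> U < \<infinity>" "open V" "snd p \<in> V" "emeasure \<rho> V < \<infinity>"
    using assms by (meson radon_measure_def)
  then show "\<exists>W. open W \<and> p \<in> W \<and> emeasure (\<mu> \<Otimes>\<^sub>M \<rho>) W < \<infinity>"
    using sets by (intro exI[of _ "U \<times> V"])
      (auto simp: open_Times mem_Times_iff \<rho>.emeasure_pair_measure_Times ennreal_mult_less_top)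
qed

lemma positive_cc_integrable:
  assumes \<rho>: "radon_measure \<rho>" and f: "positive_cc f"
  shows "integrable \<rho> f"
proof -
  have sets: "sets \<rho> = sets borel" using \<rho> by (simp add: radon_measure_def)
  obtain R where R: "\<And>x. f x \<noteq> 0 \<Longrightarrow> norm x \<le> R"
    using f by (auto simp: positive_cc_iff_zero_outside_ball)
  obtain K where K: "\<And>x. f x \<le> K" using positive_cc_bounded[OF f] by blast
  have "integrable \<rho> (\<lambda>x. K * indicator (cball 0 R) x)"
    using radon_measure_compact_finite[OF \<rho> compact_cball] sets
    by (intro integrable_mult_right integrable_real_indicator) auto
  then show ?thesis
  proof (rule Bochner_Integration.integrable_bound)
    show "f \<in> borel_measurable \<rho>"
      using positive_cc_measurable[OF f] sets by (simp cong: measurable_cong_sets)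
    show "AE x in \<rho>. norm (f x) \<le> norm (K * indicator (cball 0 R) x)"
    proof (rule AE_I2)
      show "norm (f x) \<le> norm (K * indicator (cball 0 R) x)" for x
        using K[of x] R[of x] f by (cases "f x = 0") (auto simp: positive_cc_def)
    qed
  qed
qed

lemma borel_measurable_convol:
  assumes \<rho>: "radon_measure \<rho>" and \<theta>: "positive_cc \<theta>"
  shows "convol \<theta> \<rho> \<in> borel_measurable borel"
proof -
  interpret \<rho>: sigma_finite_measure \<rho> using \<rho> by (rule radon_measure_sigma_finite)
  have [measurable_cong]: "sets \<rho> = sets borel" using \<rho> by (simp add: radon_measure_def)
  note [measurable] = positive_cc_measurable[OF \<theta>]
  show ?thesis unfolding convol_def[abs_def] by measurable
qed

lemma convol_nonneg: "positive_cc \<theta> \<Longrightarrow> 0 \<le> convol \<theta> \<rho> x"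
  unfolding convol_def by (intro Bochner_Integration.integral_nonneg) (auto simp: positive_cc_def)

section \<open>Smoothing a measure by convolution\<close>

text \<open>
  Fubini's theorem moves the convolution from the measure to the test function, where the limit of
  small supports of \<open>\<theta>\<close> can be taken pointwise.
\<close>

lemma
  fixes \<rho> :: "'a::euclidean_space measure"
  assumes \<rho>: "radon_measure \<rho>" and \<theta>: "positive_cc \<theta>" and f: "positive_cc f"
  shows integrable_mult_convol: "integrable lborel (\<lambda>x. f x * convol \<theta> \<rho> x)"
    and integral_mult_convol:
      "(LINT x|lborel. f x * convol \<theta> \<rho> x) = (LINT y|\<rho>. LINT z|lborel. f (y + z) * \<theta> z)"
proof -
  interpret \<rho>: sigma_finite_measure \<rho> using \<rho> by (rule radon_measure_sigma_finite)
  interpret pair_sigma_finite "lborel :: 'a measure" \<rho> ..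
  obtain R where R: "\<And>x. f x \<noteq> 0 \<Longrightarrow> norm x \<le> R"
    using f by (auto simp: positive_cc_iff_zero_outside_ball)
  obtain S where S: "\<And>x. \<theta> x \<noteq> 0 \<Longrightarrow> norm x \<le> S"
    using \<theta> by (auto simp: positive_cc_iff_zero_outside_ball)
  have "positive_cc (\<lambda>(x, y). f x * \<theta> (x - y))"
    unfolding positive_cc_iff_zero_outside_ball
  proof (intro conjI allI exI impI)
    have "continuous_on UNIV f" "continuous_on UNIV \<theta>"
      using f \<theta> by (auto simp: positive_cc_def)
    then have "continuous_on UNIV (\<lambda>p. f (fst p))" "continuous_on UNIV (\<lambda>p. \<theta> (fst p - snd p))"
      by (auto intro!: continuous_on_compose2[of UNIV f UNIV fst]
          continuous_on_compose2[of UNIV \<theta> UNIV "\<lambda>p. fst p - snd p"] continuous_intros)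
    then show "continuous_on UNIV (\<lambda>(x, y). f x * \<theta> (x - y))"
      unfolding case_prod_beta by (rule continuous_on_mult)
    show "0 \<le> (case p of (x, y) \<Rightarrow> f x * \<theta> (x - y))" for p
      using f \<theta> by (auto simp: positive_cc_def split: prod.split)
    show "norm p \<le> R + (R + S)" if nz: "(case p of (x, y) \<Rightarrow> f x * \<theta> (x - y)) \<noteq> 0" for p
    proof -
      obtain x y where p: "p = (x, y)" by (cases p)
      have "norm y \<le> norm x + norm (x - y)"
        using norm_triangle_ineq4[of x "x - y"] by simp
      then show ?thesis
        using norm_Pair_le[of x y] R[of x] S[of "x - y"] nz p by auto
    qed
  qed
  then have joint: "integrable (lborel \<Otimes>\<^sub>M \<rho>) (\<lambda>(x, y). f x * \<theta> (x - y))"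
    by (intro positive_cc_integrable radon_measure_pair radon_measure_lborel \<rho>)
  have inner: "(LINT y|\<rho>. f x * \<theta> (x - y)) = f x * convol \<theta> \<rho> x" for x
    by (simp add: convol_def)
  show "integrable lborel (\<lambda>x. f x * convol \<theta> \<rho> x)"
    using integrable_fst[OF joint] unfolding inner .
  have "(LINT x|lborel. f x * convol \<theta> \<rho> x) = (LINT y|\<rho>. LINT x|lborel. f x * \<theta> (x - y))"
    using Fubini_integral[OF joint] unfolding inner by (rule sym)
  also have "\<dots> = (LINT y|\<rho>. LINT z|lborel. f (y + z) * \<theta> z)"
  proof (rule Bochner_Integration.integral_cong[OF refl])
    fix y
    note [measurable] = positive_cc_measurable[OF f] positive_cc_measurable[OF \<theta>]
    have "(LINT x|lborel. f x * \<theta> (x - y)) = (LINT x|distr lborel borel ((+) y). f x * \<theta> (x - y))"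
      by (simp add: lborel_distr_plus)
    also have "\<dots> = (LINT z|lborel. f (y + z) * \<theta> z)"
      by (subst integral_distr) auto
    finally show "(LINT x|lborel. f x * \<theta> (x - y)) = (LINT z|lborel. f (y + z) * \<theta> z)" .
  qed
  finally show "(LINT x|lborel. f x * convol \<theta> \<rho> x) = (LINT y|\<rho>. LINT z|lborel. f (y + z) * \<theta> z)" .
qed

text \<open>
  The cones \<open>tent n\<close> are an approximate identity, up to normalisation, that consists of log-concave
  functions: the positive part of a concave function is log-concave by Young's inequality.
\<close>

definition tent :: "nat \<Rightarrow> 'a::euclidean_space \<Rightarrow> real" where
  "tent n x = max 0 (1 - real (Suc n) * norm x)"

lemma norm_le_if_tent_nonzero: "norm x \<le> 1 / real (Suc n)" if "tent n x \<noteq> 0"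
  using that by (auto simp: tent_def max_def field_simps split: if_splits)

lemma positive_cc_tent: "positive_cc (tent n)"
proof -
  have "continuous_on UNIV (tent n :: 'a \<Rightarrow> real)"
    unfolding tent_def[abs_def] by (intro continuous_intros)
  moreover have "0 \<le> tent n x" for x :: 'a by (simp add: tent_def)
  ultimately show ?thesis
    unfolding positive_cc_iff_zero_outside_ball using norm_le_if_tent_nonzero by blast
qed

lemma rpow_1: "0 \<le> x \<Longrightarrow> x rpow 1 = x"
  by (simp add: rpow_def)

lemma log_concave_fun_tent: "log_concave_fun (tent n)"
  unfolding log_concave_fun_def
proof (intro conjI allI impI)
  show "0 \<le> tent n x" for x :: 'a by (simp add: tent_def)
  fix x y :: 'a and s t :: real
  assume st: "0 \<le> s" "0 \<le> t" "s + t = 1"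
  consider "s = 0" | "t = 0" | "0 < s" "0 < t" "tent n x = 0 \<or> tent n y = 0"
    | "0 < s" "0 < t" "tent n x > 0" "tent n y > 0"
    using st by (fastforce simp: tent_def)
  then show "tent n x rpow s * tent n y rpow t \<le> tent n (s *\<^sub>R x + t *\<^sub>R y)"
  proof cases
    case 1
    then show ?thesis using st by (simp add: rpow_1 tent_def) (simp add: rpow_def)
  next
    case 2
    then show ?thesis using st by (simp add: rpow_1 tent_def) (simp add: rpow_def)
  next
    case 3
    then show ?thesis by (auto simp: rpow_def tent_def)
  next
    case 4
    have "tent n x rpow s * tent n y rpow t \<le> s * tent n x + t * tent n y"
      using 4 st by (simp add: rpow_def Youngs_inequality_0)
    also have "\<dots> = (s + t) - real (Suc n) * (s * norm x + t * norm y)"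
      using 4(3,4) by (simp add: tent_def max_def algebra_simps split: if_splits)
    also have "\<dots> \<le> 1 - real (Suc n) * norm (s *\<^sub>R x + t *\<^sub>R y)"
      using st norm_triangle_ineq[of "s *\<^sub>R x" "t *\<^sub>R y"]
      by (auto intro!: diff_mono mult_left_mono)
    also have "\<dots> \<le> tent n (s *\<^sub>R x + t *\<^sub>R y)" by (simp add: tent_def)
    finally show ?thesis .
  qed
qed

lemma integral_tent_pos: "0 < (LINT x|lborel. (tent n x :: real))"
proof (rule ccontr)
  let ?\<theta> = "tent n :: 'a \<Rightarrow> real" and ?U = "ball (0::'a) (1 / real (Suc n))"
  assume "\<not> 0 < (LINT x|lborel. ?\<theta> x)"
  moreover have nn: "0 \<le> ?\<theta> x" for x by (simp add: tent_def)
  ultimately have "(LINT x|lborel. ?\<theta> x) = 0"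
    by (meson Bochner_Integration.integral_nonneg not_less order_antisym)
  then have "AE x in lborel. ?\<theta> x = 0"
    using integral_nonneg_eq_0_iff_AE[OF positive_cc_integrable[OF radon_measure_lborel positive_cc_tent]] nn
    by blast
  then have "AE x in lborel. x \<notin> ?U"
    by eventually_elim (auto simp: tent_def max_def field_simps split: if_splits)
  then have "?U \<in> null_sets lborel"
    by (subst (asm) AE_iff_null_sets[symmetric]) auto
  then have "negligible ?U"
    by (simp add: negligible_iff_null_sets null_sets_completionI)
  then show False
    using open_not_negligible[of ?U] by simp
qed

text \<open>
  Under the integral over \<open>\<rho>\<close> stands the average \<open>F n y\<close> of \<open>f\<close> over the ball of radius
  \<open>1 / Suc n\<close> about \<open>y\<close>, weighted by the cone. It tends to \<open>f y\<close> by continuity, it is bounded by the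
  maximum of \<open>f\<close>, and it vanishes outside a fixed ball, which has finite measure.
\<close>

lemma tent_average_tendsto:
  fixes \<rho> :: "'a::euclidean_space measure"
  assumes \<rho>: "radon_measure \<rho>" and f: "positive_cc f"
  shows "(\<lambda>n. (LINT x|lborel. f x * convol (tent n) \<rho> x) / (LINT z|lborel. tent n (z::'a)))
    \<longlonglongrightarrow> (LINT y|\<rho>. f y)"
proof -
  define \<kappa> where "\<kappa> n = (LINT z|lborel. tent n (z::'a))" for n
  define F where "F n y = (LINT z|lborel. f (y + z) * tent n z) / \<kappa> n" for n y
  have \<kappa>: "0 < \<kappa> n" for n unfolding \<kappa>_def by (rule integral_tent_pos)
  interpret \<rho>: sigma_finite_measure \<rho> using \<rho> by (rule radon_measure_sigma_finite)
  have sets[measurable_cong]: "sets \<rho> = sets borel" using \<rho> by (simp add: radon_measure_def)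
  note [measurable] = positive_cc_measurable[OF f] positive_cc_measurable[OF positive_cc_tent]
  obtain R where R: "\<And>x. f x \<noteq> 0 \<Longrightarrow> norm x \<le> R"
    using f by (auto simp: positive_cc_iff_zero_outside_ball)
  obtain K where K: "\<And>x. f x \<le> K" using positive_cc_bounded[OF f] by blast
  have f0: "0 \<le> f x" for x using f by (simp add: positive_cc_def)
  have t0: "0 \<le> tent n x" for n and x :: 'a by (simp add: tent_def)
  have int: "integrable lborel (\<lambda>z. f (y + z) * tent n z)" for n y
    by (intro positive_cc_integrable radon_measure_lborel positive_cc_mult_shift f positive_cc_tent)
  have int_tent: "integrable lborel (\<lambda>z. c * tent n (z::'a))" for n c
    by (intro integrable_mult_right positive_cc_integrable radon_measure_lborel positive_cc_tent)
  have F_le: "F n y \<le> c" if "\<And>z. norm z \<le> 1 / real (Suc n) \<Longrightarrow> f (y + z) \<le> c" for n y c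
  proof -
    have "f (y + z) * tent n z \<le> c * tent n z" for z
      using that[of z] t0[of n z] norm_le_if_tent_nonzero[of n z]
      by (cases "tent n z = 0") (auto intro: mult_right_mono)
    then have "(LINT z|lborel. f (y + z) * tent n z) \<le> (LINT z|lborel. c * tent n (z::'a))"
      by (intro Bochner_Integration.integral_mono int int_tent)
    then show ?thesis using \<kappa>[of n] by (simp add: F_def \<kappa>_def[symmetric] pos_divide_le_eq)
  qed
  have F_ge: "c \<le> F n y" if "\<And>z. norm z \<le> 1 / real (Suc n) \<Longrightarrow> c \<le> f (y + z)" for n y c
  proof -
    have "c * tent n z \<le> f (y + z) * tent n z" for z
      using that[of z] t0[of n z] norm_le_if_tent_nonzero[of n z]
      by (cases "tent n z = 0") (auto intro: mult_right_mono)
    then have "(LINT z|lborel. c * tent n (z::'a)) \<le> (LINT z|lborel. f (y + z) * tent n z)"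
      by (intro Bochner_Integration.integral_mono int int_tent)
    then show ?thesis using \<kappa>[of n] by (simp add: F_def \<kappa>_def[symmetric] pos_le_divide_eq)
  qed
  have "(\<lambda>n. LINT y|\<rho>. F n y) \<longlonglongrightarrow> (LINT y|\<rho>. f y)"
  proof (rule integral_dominated_convergence[where w="\<lambda>y. K * indicator (cball 0 (R + 1)) y"])
    show "f \<in> borel_measurable \<rho>" by measurable
    show "F n \<in> borel_measurable \<rho>" for n
      unfolding F_def by measurable
    show "integrable \<rho> (\<lambda>y. K * indicator (cball 0 (R + 1)) y)"
      using radon_measure_compact_finite[OF \<rho> compact_cball] sets
      by (intro integrable_mult_right integrable_real_indicator) auto
    show "AE y in \<rho>. (\<lambda>n. F n y) \<longlonglongrightarrow> f y"
    proof (intro AE_I2 LIMSEQ_I)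
      fix y and \<epsilon> :: real assume "0 < \<epsilon>"
      have "isCont f y"
        using f by (simp add: positive_cc_def continuous_on_eq_continuous_at)
      then obtain \<delta> where \<delta>: "\<delta> > 0" "\<And>x. dist x y < \<delta> \<Longrightarrow> dist (f x) (f y) < \<epsilon> / 2"
        unfolding continuous_at_eps_delta using \<open>0 < \<epsilon>\<close> by (metis half_gt_zero)
      obtain N where N: "1 / real (Suc N) < \<delta>" using nat_approx_posE[OF \<delta>(1)] by blast
      show "\<exists>N. \<forall>n\<ge>N. norm (F n y - f y) < \<epsilon>"
      proof (intro exI[of _ N] allI impI)
        fix n assume "N \<le> n"
        then have "1 / real (Suc n) < \<delta>"
          using N by (meson le_less_trans inverse_of_nat_le order_trans frac_le of_nat_0_less_iff of_nat_mono
              Suc_le_mono zero_less_Suc zero_le_one order_refl)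
        then have near: "\<bar>f (y + z) - f y\<bar> \<le> \<epsilon> / 2" if "norm z \<le> 1 / real (Suc n)" for z
          using \<delta>(2)[of "y + z"] that by (simp add: dist_norm)
        have "f y - \<epsilon> / 2 \<le> f (y + z)" "f (y + z) \<le> f y + \<epsilon> / 2"
          if "norm z \<le> 1 / real (Suc n)" for z
          using near[OF that] by linarith+
        then have "f y - \<epsilon> / 2 \<le> F n y" "F n y \<le> f y + \<epsilon> / 2"
          by (blast intro: F_ge F_le)+
        then show "norm (F n y - f y) < \<epsilon>" using \<open>0 < \<epsilon>\<close> by (simp add: abs_le_iff abs_less_iff)
      qed
    qed
    show "AE y in \<rho>. norm (F n y) \<le> K * indicator (cball 0 (R + 1)) y" for n
    proof (rule AE_I2)
      fix y
      have "0 \<le> F n y" "F n y \<le> K" using f0 K by (auto intro: F_ge F_le)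
      moreover have "F n y \<le> 0" if "R + 1 < norm y"
      proof (rule F_le)
        fix z :: 'a assume "norm z \<le> 1 / real (Suc n)"
        also have "1 / real (Suc n) \<le> 1" by simp
        finally have "R < norm (y + z)"
          using that norm_triangle_ineq4[of "y + z" z] by simp
        then show "f (y + z) \<le> 0" using R[of "y + z"] by force
      qed
      ultimately show "norm (F n y) \<le> K * indicator (cball 0 (R + 1)) y"
        by (auto simp: indicator_def not_le)
    qed
  qed
  moreover have "(LINT y|\<rho>. F n y) = (LINT x|lborel. f x * convol (tent n) \<rho> x) / \<kappa> n" for n
    unfolding F_def by (simp add: integral_mult_convol[OF \<rho> positive_cc_tent f])
  ultimately show ?thesis by (simp add: \<kappa>_def)
qed

section \<open>The equivalence\<close>

text \<open>
  Multiplying the hypothesis on \<open>a\<close>, \<open>b\<close>, \<open>c\<close> by the log-concavity inequality of \<open>g\<close> gives the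
  same hypothesis for \<open>a * g\<close>, \<open>b * g\<close>, \<open>c * g\<close>, to which the inequality for Lebesgue measure applies.
\<close>

lemma log_concave_density_prekopa_leindler:
  fixes a b c g :: "'a::euclidean_space \<Rightarrow> real"
  assumes g: "log_concave_fun g"
    and int: "integrable lborel (\<lambda>x. a x * g x)" "integrable lborel (\<lambda>x. b x * g x)" "integrable lborel (\<lambda>x. c x * g x)"
    and nn: "\<And>x. 0 \<le> a x" "\<And>x. 0 \<le> b x" "\<And>x. 0 \<le> c x"
    and st: "0 < s" "0 < t" "s + t = 1"
    and le: "\<And>x y. b x powr s * c y powr t \<le> a (s *\<^sub>R x + t *\<^sub>R y)"
  shows "(LINT x|lborel. b x * g x) powr s * (LINT x|lborel. c x * g x) powr t \<le> (LINT x|lborel. a x * g x)"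
proof -
  have g0: "0 \<le> g x" for x using g by (simp add: log_concave_fun_def)
  have "ennreal ((LINT x|lborel. b x * g x) powr s * (LINT x|lborel. c x * g x) powr t)
      \<le> (\<integral>\<^sup>+x. ennreal (a x * g x) \<partial>lborel)"
  proof (rule prekopa_leindler_lborel)
    fix x y :: 'a
    let ?z = "s *\<^sub>R x + t *\<^sub>R y"
    have "g x rpow s * g y rpow t \<le> g ?z"
      using g st by (simp add: log_concave_fun_def)
    then have "g x powr s * g y powr t \<le> g ?z"
      using st by (simp add: rpow_def)
    then have "(b x powr s * c y powr t) * (g x powr s * g y powr t) \<le> a ?z * g ?z"
      using le nn by (intro mult_mono) auto
    then show "ennreal ((b x * g x) powr s * (c y * g y) powr t) \<le> ennreal (a ?z * g ?z)"
      using nn g0 by (intro ennreal_leI) (simp add: powr_mult mult_ac)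
  qed (use int st nn g0 in auto)
  also have "\<dots> = ennreal (LINT x|lborel. a x * g x)"
    using int nn g0 by (intro nn_integral_eq_integral) auto
  finally show ?thesis
    using nn g0 by (subst (asm) ennreal_le_iff) (auto intro!: Bochner_Integration.integral_nonneg)
qed

text \<open>
  The convolution of \<open>\<rho>\<close> with a cone is a measure with log-concave density and hence satisfies the
  inequality; since \<open>s + t = 1\<close>, the normalising constant of the cone cancels, and the inequality
  passes to the limit. If one weight is \<open>0\<close>, the convention
  \<open>0 rpow 0 = 1\<close> turns the hypothesis for \<open>x = y\<close> into \<open>c x \<le> a x\<close> or \<open>b x \<le> a x\<close>, and monotonicity of the
  integral is enough.
\<close>

lemma log_concave_measure_imp_prekopa_leindler:
  fixes \<rho> :: "'a::euclidean_space measure"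
  assumes \<rho>: "radon_measure \<rho>" and lc: "log_concave_measure \<rho>"
  shows "prekopa_leindler \<rho>"
  unfolding prekopa_leindler_def
proof (intro allI impI)
  fix s t :: real and a b c :: "'a \<Rightarrow> real"
  assume st: "0 \<le> s" "0 \<le> t" "s + t = 1"
    and a: "positive_cc a" and b: "positive_cc b" and c: "positive_cc c"
    and le: "\<forall>x y. a (s *\<^sub>R x + t *\<^sub>R y) \<ge> b x rpow s * c y rpow t"
  have nn: "0 \<le> a x" "0 \<le> b x" "0 \<le> c x" for x
    using a b c by (auto simp: positive_cc_def)
  note int = positive_cc_integrable[OF \<rho>]
  have int_nn: "0 \<le> (LINT x|\<rho>. b x)" "0 \<le> (LINT x|\<rho>. c x)"
    using nn by (auto intro: Bochner_Integration.integral_nonneg)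
  consider "s = 0" "t = 1" | "s = 1" "t = 0" | "0 < s" "0 < t"
    using st by fastforce
  then show "(LINT x|\<rho>. a x) \<ge> (LINT x|\<rho>. b x) rpow s * (LINT x|\<rho>. c x) rpow t"
  proof cases
    case 1
    then have "c x \<le> a x" for x
      using le[rule_format, of x x] nn by (simp add: rpow_def)
    then show ?thesis
      using 1 int_nn Bochner_Integration.integral_mono[OF int[OF c] int[OF a]] by (simp add: rpow_def)
  next
    case 2
    then have "b x \<le> a x" for x
      using le[rule_format, of x x] nn by (simp add: rpow_def)
    then show ?thesis
      using 2 int_nn Bochner_Integration.integral_mono[OF int[OF b] int[OF a]] by (simp add: rpow_def)
  next
    case 3
    define J where "J f n = (LINT x|lborel. f x * convol (tent n) \<rho> x)" for f n
    define \<kappa> where "\<kappa> n = (LINT z|lborel. tent n (z::'a))" for n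
    have \<kappa>: "0 < \<kappa> n" for n unfolding \<kappa>_def by (rule integral_tent_pos)
    have J0: "0 \<le> J b n" "0 \<le> J c n" for n
      unfolding J_def
      by (auto intro!: Bochner_Integration.integral_nonneg mult_nonneg_nonneg nn convol_nonneg positive_cc_tent)
    have le': "b x powr s * c y powr t \<le> a (s *\<^sub>R x + t *\<^sub>R y)" for x y
      using le 3 by (simp add: rpow_def)
    have J_le: "J b n powr s * J c n powr t \<le> J a n" for n
    proof -
      let ?h = "convol (tent n) \<rho>"
      note [measurable] = borel_measurable_convol[OF \<rho> positive_cc_tent]
        positive_cc_measurable[OF a] positive_cc_measurable[OF b] positive_cc_measurable[OF c]
      have "has_log_concave_density (density lborel (\<lambda>x. ennreal (?h x)))"
        using lc log_concave_fun_tent positive_cc_tent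
        unfolding log_concave_measure_def positive_cc_def by blast
      then obtain g where g[measurable]: "g \<in> borel_measurable borel" and lcg: "log_concave_fun g"
        and "density lborel (\<lambda>x. ennreal (?h x)) = density lborel (\<lambda>x. ennreal (g x))"
        unfolding has_log_concave_density_def by blast
      then have "AE x in lborel. ennreal (?h x) = ennreal (g x)"
        by (subst (asm) sigma_finite_measure.density_unique_iff[OF sigma_finite_lborel]) auto
      then have hg: "AE x in lborel. ?h x = g x"
      proof eventually_elim
        case (elim x)
        have hx: "0 \<le> ?h x" by (rule convol_nonneg[OF positive_cc_tent])
        have "0 \<le> g x" using lcg by (simp add: log_concave_fun_def)
        with elim hx show ?case
          by (simp add: ennreal_inj)
      qed
      have f_g: "integrable lborel (\<lambda>x. f x * g x)" "J f n = (LINT x|lborel. f x * g x)"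
        if f: "positive_cc f" for f
      proof -
        note [measurable] = positive_cc_measurable[OF f]
        have eq: "AE x in lborel. f x * ?h x = f x * g x" using hg by eventually_elim simp
        show "integrable lborel (\<lambda>x. f x * g x)"
          by (rule integrable_cong_AE_imp[OF integrable_mult_convol[OF \<rho> positive_cc_tent f]])
             (use eq in auto)
        show "J f n = (LINT x|lborel. f x * g x)"
          unfolding J_def by (rule integral_cong_AE) (use eq in auto)
      qed
      show ?thesis
        unfolding f_g(2)[OF a] f_g(2)[OF b] f_g(2)[OF c]
        using log_concave_density_prekopa_leindler[OF lcg f_g(1)[OF a] f_g(1)[OF b] f_g(1)[OF c] nn 3 st(3) le'] .
    qed
    have "(J b n / \<kappa> n) powr s * (J c n / \<kappa> n) powr t \<le> J a n / \<kappa> n" for n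
    proof -
      have "\<kappa> n powr s * \<kappa> n powr t = \<kappa> n"
        using \<kappa>[of n] st by (simp add: powr_add[symmetric])
      then have "(J b n / \<kappa> n) powr s * (J c n / \<kappa> n) powr t = J b n powr s * J c n powr t / \<kappa> n"
        using J0 \<kappa>[of n] by (simp add: powr_divide)
      then show ?thesis using J_le[of n] \<kappa>[of n] by (simp add: divide_right_mono)
    qed
    moreover have lim: "(\<lambda>n. J f n / \<kappa> n) \<longlonglongrightarrow> (LINT y|\<rho>. f y)" if "positive_cc f" for f
      unfolding J_def \<kappa>_def by (rule tent_average_tendsto[OF \<rho> that])
    moreover have "(\<lambda>n. (J b n / \<kappa> n) powr s * (J c n / \<kappa> n) powr t)
        \<longlonglongrightarrow> (LINT x|\<rho>. b x) powr s * (LINT x|\<rho>. c x) powr t"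
      using 3 J0 \<kappa> by (intro tendsto_mult tendsto_powr2 lim b c tendsto_const always_eventually)
        (auto simp: less_imp_le)
    ultimately have "(LINT x|\<rho>. b x) powr s * (LINT x|\<rho>. c x) powr t \<le> (LINT x|\<rho>. a x)"
      using lim[OF a] by (intro LIMSEQ_le) auto
    then show ?thesis using 3 by (simp add: rpow_def)
  qed
qed

text \<open>
  The values of \<open>convol \<theta> \<rho>\<close> at \<open>x\<close>, \<open>y\<close> and \<open>s *\<^sub>R x + t *\<^sub>R y\<close> are the integrals of reflected translates of
  \<open>\<theta>\<close>, and log-concavity of \<open>\<theta>\<close> is the hypothesis of the inequality for these three functions. Thus the
  convolution itself is the log-concave density.
\<close>

lemma prekopa_leindler_imp_log_concave_measure:
  fixes \<rho> :: "'a::euclidean_space measure"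
  assumes \<rho>: "radon_measure \<rho>" and pl: "prekopa_leindler \<rho>"
  shows "log_concave_measure \<rho>"
  unfolding log_concave_measure_def
proof (intro allI impI)
  fix \<theta> :: "'a \<Rightarrow> real"
  assume lc: "log_concave_fun \<theta>" and "continuous_on UNIV \<theta>" "compact_support \<theta>"
  then have \<theta>: "positive_cc \<theta>" by (simp add: positive_cc_def log_concave_fun_def)
  have "log_concave_fun (convol \<theta> \<rho>)"
    unfolding log_concave_fun_def
  proof (intro conjI allI impI)
    show "0 \<le> convol \<theta> \<rho> x" for x by (rule convol_nonneg[OF \<theta>])
    fix x y :: 'a and s t :: real
    assume st: "0 \<le> s" "0 \<le> t" "s + t = 1"
    have "\<theta> (x - u) rpow s * \<theta> (y - v) rpow t \<le> \<theta> (s *\<^sub>R x + t *\<^sub>R y - (s *\<^sub>R u + t *\<^sub>R v))" for u v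
    proof -
      have "s *\<^sub>R x + t *\<^sub>R y - (s *\<^sub>R u + t *\<^sub>R v) = s *\<^sub>R (x - u) + t *\<^sub>R (y - v)"
        by (simp add: algebra_simps)
      then show ?thesis using lc st by (simp add: log_concave_fun_def)
    qed
    then show "convol \<theta> \<rho> x rpow s * convol \<theta> \<rho> y rpow t \<le> convol \<theta> \<rho> (s *\<^sub>R x + t *\<^sub>R y)"
      unfolding convol_def
      using pl[unfolded prekopa_leindler_def, rule_format, of s t
          "\<lambda>z. \<theta> (s *\<^sub>R x + t *\<^sub>R y - z)" "\<lambda>z. \<theta> (x - z)" "\<lambda>z. \<theta> (y - z)"]
        st positive_cc_reflect[OF \<theta>] by blast
  qed
  then show "has_log_concave_density (density lborel (\<lambda>x. ennreal (convol \<theta> \<rho> x)))"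
    using borel_measurable_convol[OF \<rho> \<theta>] unfolding has_log_concave_density_def by blast
qed

theorem theorem2:
  fixes \<rho> :: "'a::euclidean_space measure"
  assumes "radon_measure \<rho>"
  shows "log_concave_measure \<rho> \<longleftrightarrow> prekopa_leindler \<rho>"
  using assms log_concave_measure_imp_prekopa_leindler prekopa_leindler_imp_log_concave_measure by blast

end
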